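(* Let $f:\mathbb{B}^n\to\mathbb{B}^N_l$ be a proper polynomial map of degree $d$. Assume that $\Gamma_f$ contains an automorphism that moves the origin. Then there is a coordinate function $z_j$ (with $1\le j\le n$) such that each monomial $z_j^k$, for $1\le k\le d$, appears in $f$.
   Context: $\mathbb{B}^n$ is the open unit ball of $\mathbb{C}^n$ and $\mathrm{Aut}(\mathbb{B}^n)$ is its group of holomorphic automorphisms. For $N=m+l$ put $\|w\|_l^2=\sum_{j=1}^m|w_j|^2-\sum_{j=m+1}^{m+l}|w_j|^2$ on $\mathbb{C}^N$. The generalized unit ball $\mathbb{B}^N_l\subset\mathbb{P}^N$ is the set of points with homogeneous coordinates $[w,\zeta]$, $w\in\mathbb{C}^N$, $\zeta\in\mathbb{C}$, for which $\|w\|_l^2<|\zeta|^2$ (for $l=0$ it is the unit ball $\mathbb{B}^N$). Its automorphism group $\mathrm{Aut}(\mathbb{B}^N_l)$ is the quotient of $\mathbf{SU}(N-l,l+1)$ by its center, acting by linear fractional transformations. A polynomial map $f$ into $\mathbb{C}^N$ is regarded as the map $z\mapsto[f(z),1]$ into $\mathbb{P}^N$. The Hermitian invariant group of a proper rational map $f:\mathbb{B}^n\to\mathbb{B}^N_l$ is $$\Gamma_f=\{\gamma\in\mathrm{Aut}(\mathbb{B}^n):\ \text{there is } \psi\in\mathrm{Aut}(\mathbb{B}^N_l)\text{ with } f\circ\gamma=\psi\circ f\}.$$ A monomial appears in $f$ if its (vector) coefficient in $f$ is nonzero. An automorphism $\gamma$ moves the origin if $\gamma(0)\ne0$. *)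

theory Defs
  imports "HOL-Analysis.Analysis" "HOL-Library.Poly_Mapping"
begin

section \<open>Polynomial maps from complex n-space to complex N-space\<close>

text \<open>
  A polynomial map is given by its finitely many nonzero vector coefficients, indexed by
  multi-indices (exponent vectors); the monomials appearing in it are those with exponent in
  \<^const>\<open>Poly_Mapping.keys\<close>.
\<close>

type_synonym ('n, 'N) polymap = "(nat ^ 'n) \<Rightarrow>\<^sub>0 (complex ^ 'N)"

definition monomial_val :: "nat ^ 'n::finite \<Rightarrow> complex ^ 'n \<Rightarrow> complex" where
  "monomial_val \<alpha> z = (\<Prod>j\<in>UNIV. (z $ j) ^ (\<alpha> $ j))"

definition eval_polymap :: "('n::finite, 'N::finite) polymap \<Rightarrow> complex ^ 'n \<Rightarrow> complex ^ 'N" where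
  "eval_polymap p z = (\<Sum>\<alpha>\<in>Poly_Mapping.keys p. monomial_val \<alpha> z *s Poly_Mapping.lookup p \<alpha>)"

text \<open>The zero map gets degree 0.\<close>

definition polymap_degree :: "('n::finite, 'N::finite) polymap \<Rightarrow> nat" where
  "polymap_degree p = Max (insert 0 ((\<lambda>\<alpha>. \<Sum>j\<in>UNIV. \<alpha> $ j) ` Poly_Mapping.keys p))"

definition appears_in :: "nat ^ 'n \<Rightarrow> ('n::finite, 'N::finite) polymap \<Rightarrow> bool" where
  "appears_in \<alpha> p \<longleftrightarrow> Poly_Mapping.lookup p \<alpha> \<noteq> 0"

section \<open>Holomorphic automorphisms of the unit ball\<close>

definition holomorphic_map_on ::
    "(complex ^ 'n::finite) set \<Rightarrow> (complex ^ 'n \<Rightarrow> complex ^ 'm::finite) \<Rightarrow> bool" where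
  "holomorphic_map_on S f \<longleftrightarrow>
     (\<forall>z\<in>S. \<exists>A :: complex ^ 'n ^ 'm. (f has_derivative (\<lambda>h. A *v h)) (at z within S))"

abbreviation unit_ball :: "(complex ^ 'n::finite) set" where
  "unit_ball \<equiv> ball 0 1"

text \<open>Extensionality makes each automorphism of the ball correspond to exactly one function.\<close>

definition ball_aut :: "(complex ^ 'n::finite \<Rightarrow> complex ^ 'n) set" where
  "ball_aut = {\<gamma> \<in> extensional unit_ball.
     bij_betw \<gamma> unit_ball unit_ball \<and>
     holomorphic_map_on unit_ball \<gamma> \<and>
     holomorphic_map_on unit_ball (inv_into unit_ball \<gamma>)}"

section \<open>Complex projective space\<close>

text \<open>
  Homogeneous coordinates are indexed by \<^typ>\<open>'N option\<close>: \<^term>\<open>Some j\<close> for the coordinates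
  of \<open>w\<close> and \<^term>\<open>None\<close> for \<open>\<zeta>\<close>. A point of projective space is a complex line through the
  origin, as a set of vectors.
\<close>

definition homog :: "complex ^ 'N::finite \<Rightarrow> complex \<Rightarrow> complex ^ 'N option" where
  "homog w \<zeta> = (\<chi> i. case i of None \<Rightarrow> \<zeta> | Some j \<Rightarrow> w $ j)"

definition line :: "complex ^ 'k::finite \<Rightarrow> (complex ^ 'k) set" where
  "line v = range (\<lambda>c. c *s v)"

text \<open>The quotient topology, see \<open>quotient_map_line\<close> below.\<close>

definition proj_space :: "(complex ^ 'k::finite) set topology" where
  "proj_space = topology (\<lambda>U. U \<subseteq> line ` (UNIV - {0}) \<and> open {v. v \<noteq> 0 \<and> line v \<in> U})"

lemma openin_proj_space:
  "openin proj_space U \<longleftrightarrow>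
     U \<subseteq> line ` (UNIV - {0 :: complex ^ 'k::finite}) \<and> open {v. v \<noteq> 0 \<and> line v \<in> U}"
proof -
  let ?P = "\<lambda>U. U \<subseteq> line ` (UNIV - {0 :: complex ^ 'k}) \<and> open {v. v \<noteq> 0 \<and> line v \<in> U}"
  have "istopology ?P"
    unfolding istopology_def
  proof (intro conjI allI impI)
    fix S T assume "?P S" "?P T"
    moreover have "{v. v \<noteq> 0 \<and> line v \<in> S \<inter> T} =
        {v. v \<noteq> 0 \<and> line v \<in> S} \<inter> {v. v \<noteq> 0 \<and> line v \<in> T}" by auto
    ultimately show "S \<inter> T \<subseteq> line ` (UNIV - {0})" "open {v. v \<noteq> 0 \<and> line v \<in> S \<inter> T}"
      by (auto simp: open_Int)
  next
    fix \<K> assume *: "\<forall>K\<in>\<K>. ?P K"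
    then show "\<Union>\<K> \<subseteq> line ` (UNIV - {0})" by blast
    have "{v. v \<noteq> 0 \<and> line v \<in> \<Union>\<K>} = (\<Union>K\<in>\<K>. {v. v \<noteq> 0 \<and> line v \<in> K})" by auto
    then show "open {v. v \<noteq> 0 \<and> line v \<in> \<Union>\<K>}" using * by (simp add: open_UN)
  qed
  then show ?thesis unfolding proj_space_def by simp
qed

lemma topspace_proj_space:
  "topspace proj_space = line ` (UNIV - {0 :: complex ^ 'k::finite})"
proof (rule antisym)
  show "topspace proj_space \<subseteq> line ` (UNIV - {0 :: complex ^ 'k})"
    using openin_proj_space[of "topspace proj_space"] by blast
  have "{v. v \<noteq> 0 \<and> line v \<in> line ` (UNIV - {0 :: complex ^ 'k})} = - {0}" by auto
  then have "openin proj_space (line ` (UNIV - {0 :: complex ^ 'k}))"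
    by (simp add: openin_proj_space open_Compl)
  then show "line ` (UNIV - {0 :: complex ^ 'k}) \<subseteq> topspace proj_space"
    by (rule openin_subset)
qed

lemma quotient_map_line:
  "quotient_map (top_of_set (UNIV - {0 :: complex ^ 'k::finite})) proj_space line"
  unfolding quotient_map_def
proof (intro conjI allI impI)
  show "line ` topspace (top_of_set (UNIV - {0})) = topspace (proj_space :: (complex ^ 'k) set topology)"
    by (simp add: topspace_proj_space)
  fix U :: "(complex ^ 'k) set set"
  assume U: "U \<subseteq> topspace proj_space"
  have "{x \<in> topspace (top_of_set (UNIV - {0})). line x \<in> U} = {v. v \<noteq> 0 \<and> line v \<in> U}" by auto
  moreover have "openin (top_of_set (UNIV - {0})) V \<longleftrightarrow> V \<subseteq> UNIV - {0} \<and> open V"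
    for V :: "(complex ^ 'k) set"
    using openin_open_eq[of "UNIV - {0 :: complex ^ 'k}" V] by auto
  ultimately show "openin (top_of_set (UNIV - {0}))
      {x \<in> topspace (top_of_set (UNIV - {0})). line x \<in> U} = openin proj_space U"
    using U by (auto simp: openin_proj_space topspace_proj_space)
qed

section \<open>The generalized ball and its automorphisms\<close>

text \<open>
  The set \<open>L\<close> consists of the coordinates carrying a minus sign, so \<open>l = card L\<close> and
  \<open>m = card (- L)\<close>; \<open>L = {}\<close> gives the ordinary unit ball. No ordering of the index type is needed.
\<close>

definition norm_sq :: "'N set \<Rightarrow> complex ^ 'N::finite \<Rightarrow> real" where
  "norm_sq L w = (\<Sum>j\<in>- L. (cmod (w $ j))\<^sup>2) - (\<Sum>j\<in>L. (cmod (w $ j))\<^sup>2)"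

definition gen_ball :: "'N::finite set \<Rightarrow> (complex ^ 'N option) set set" where
  "gen_ball L = {line (homog w \<zeta>) | w \<zeta>. norm_sq L w < (cmod \<zeta>)\<^sup>2}"

text \<open>
  The sesquilinear form whose quadratic form is \<open>norm_sq L w - (cmod \<zeta>)\<^sup>2\<close>; it has \<open>N - l\<close>
  plus signs and \<open>l + 1\<close> minus signs.
\<close>

definition herm_form ::
    "'N::finite set \<Rightarrow> complex ^ 'N option \<Rightarrow> complex ^ 'N option \<Rightarrow> complex" where
  "herm_form L u v =
     (\<Sum>j\<in>- L. u $ Some j * cnj (v $ Some j)) - (\<Sum>j\<in>L. u $ Some j * cnj (v $ Some j))
       - u $ None * cnj (v $ None)"

definition SU_form :: "'N::finite set \<Rightarrow> (complex ^ 'N option ^ 'N option) set" where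
  "SU_form L = {A. det A = 1 \<and> (\<forall>u v. herm_form L (A *v u) (A *v v) = herm_form L u v)}"

text \<open>
  Passing from matrices to the maps they induce on the generalized ball is the quotient of
  \<open>SU(N - l, l + 1)\<close> by its center.
\<close>

definition gen_ball_aut ::
    "'N::finite set \<Rightarrow> ((complex ^ 'N option) set \<Rightarrow> (complex ^ 'N option) set) set" where
  "gen_ball_aut L = {restrict ((`) ((*v) A)) (gen_ball L) | A. A \<in> SU_form L}"

definition proj_polymap ::
    "('n::finite, 'N::finite) polymap \<Rightarrow> complex ^ 'n \<Rightarrow> (complex ^ 'N option) set" where
  "proj_polymap p z = line (homog (eval_polymap p z) 1)"

definition proper_ball_map ::
    "'N::finite set \<Rightarrow> (complex ^ 'n::finite \<Rightarrow> (complex ^ 'N option) set) \<Rightarrow> bool" where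
  "proper_ball_map L F \<longleftrightarrow>
     F \<in> unit_ball \<rightarrow> gen_ball L \<and>
     proper_map (top_of_set unit_ball) (subtopology proj_space (gen_ball L)) F"

definition invariant_group ::
    "'N::finite set \<Rightarrow> (complex ^ 'n::finite \<Rightarrow> (complex ^ 'N option) set)
       \<Rightarrow> (complex ^ 'n \<Rightarrow> complex ^ 'n) set" where
  "invariant_group L F =
     {\<gamma> \<in> ball_aut. \<exists>\<psi>\<in>gen_ball_aut L. \<forall>z\<in>unit_ball. F (\<gamma> z) = \<psi> (F z)}"

end

theory Submission
  imports Defs "HOL-Complex_Analysis.Conformal_Mappings"
begin

text \<open>
  The idea is to compare poles. Let \<open>\<gamma>\<close> be an automorphism of the ball with \<open>\<gamma> 0 \<noteq> 0\<close> and
  \<open>f \<circ> \<gamma> = \<psi> \<circ> f\<close>. By the classical description of the automorphisms of the ball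
  (\<open>ball_aut_factorization\<close>), \<open>\<gamma>\<close> is a linear isomorphism \<open>U\<close> composed with the Moebius involution that
  exchanges \<open>0\<close> and \<open>b = \<gamma>\<^sup>-\<^sup>1 0 \<noteq> 0\<close>. It is therefore linear fractional, with the nonconstant
  denominator \<open>q z = 1 - \<langle>z, b\<rangle>\<close>, and it carries the hyperplane \<open>q = 0\<close> onto the hyperplane at
  infinity.

  Let \<open>\<psi>\<close> be induced by the matrix \<open>A\<close>, and let \<open>h\<close> be the last entry of \<open>A (f, 1)\<close>. It is a polynomial of
  degree at most \<open>d\<close>, namely a constant plus a linear combination of the components of \<open>f\<close>, and
  \<open>h (f \<circ> \<gamma>)\<close> is the polynomial map given by the other entries. Since \<open>f\<close> has degree \<open>d\<close>, some
  component of it has a pole of order \<open>d\<close> at infinity, and the same component of \<open>f \<circ> \<gamma>\<close> has a pole of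
  order \<open>d\<close> along \<open>q = 0\<close>. The factor \<open>h\<close> has to cancel it, so \<open>q\<^sup>d\<close> divides \<open>h\<close>, and comparing degrees
  gives \<open>h = h 0 \<cdot> q\<^sup>d\<close> with \<open>h 0 \<noteq> 0\<close>.

  Now choose \<open>j\<close> with \<open>b\<^sub>j \<noteq> 0\<close>. Every pure power of \<open>z\<^sub>j\<close> up to the \<open>d\<close>-th has a nonzero coefficient in
  \<open>q\<^sup>d\<close>, hence in \<open>h\<close>; for positive exponents it can only come from \<open>f\<close>
  (\<open>pure_powers_of_linear_power\<close>).

  Divisibility is needed only for polynomials in one variable: the identity \<open>h = h 0 \<cdot> q\<^sup>d\<close> is proved on
  each generic line through the origin (\<open>denominator_on_generic_line\<close>) and then extended to the
  coordinate axes by continuity (\<open>denominator_on_line\<close>).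
\<close>

section \<open>The Hermitian inner product\<close>

definition cdot :: "complex ^ 'n::finite \<Rightarrow> complex ^ 'n \<Rightarrow> complex" where
  "cdot z w = (\<Sum>j\<in>UNIV. z $ j * cnj (w $ j))"

lemma cdot_add_left: "cdot (x + y) w = cdot x w + cdot y w"
  by (simp add: cdot_def algebra_simps sum.distrib)

lemma cdot_diff_left: "cdot (x - y) w = cdot x w - cdot y w"
  by (simp add: cdot_def algebra_simps sum_subtractf)

lemma cdot_scale_left: "cdot (c *s x) w = c * cdot x w"
  by (simp add: cdot_def sum_distrib_left mult.assoc)

lemma cdot_commute: "cdot w z = cnj (cdot z w)"
  by (simp add: cdot_def mult.commute)

lemma cdot_diff_right: "cdot w (x - y) = cdot w x - cdot w y"
  by (simp add: cdot_def algebra_simps sum_subtractf)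

lemma cdot_scale_right: "cdot w (c *s x) = cnj c * cdot w x"
  by (simp add: cdot_def sum_distrib_left algebra_simps)

lemma cdot_zero [simp]: "cdot 0 w = 0" "cdot w 0 = 0"
  by (simp_all add: cdot_def)

lemmas cdot_simps = cdot_add_left cdot_diff_left cdot_scale_left cdot_diff_right cdot_scale_right

lemma cdot_self: "cdot z z = of_real ((norm z)\<^sup>2)"
proof -
  have "(norm z)\<^sup>2 = (\<Sum>j\<in>UNIV. (cmod (z $ j))\<^sup>2)"
    by (simp add: norm_vec_def L2_set_def sum_nonneg)
  then show ?thesis
    by (simp add: cdot_def complex_norm_square[symmetric])
qed

lemma norm_cdot_le: "cmod (cdot z w) \<le> norm z * norm w"
proof -
  have "cmod (cdot z w) \<le> (\<Sum>j\<in>UNIV. \<bar>cmod (z $ j)\<bar> * \<bar>cmod (w $ j)\<bar>)"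
    unfolding cdot_def by (rule order_trans[OF norm_sum]) (simp add: norm_mult)
  also have "\<dots> \<le> norm z * norm w"
    unfolding norm_vec_def by (rule L2_set_mult_ineq)
  finally show ?thesis .
qed

lemma cdot_axis_left: "cdot (axis j 1) b = cnj (b $ j)"
proof -
  have "cdot (axis j 1) b = (\<Sum>i\<in>UNIV. if i = j then cnj (b $ j) else 0)"
    unfolding cdot_def by (rule sum.cong) (auto simp: axis_def)
  then show ?thesis by simp
qed

lemma norm_scale_vec: "norm (c *s (z :: complex ^ 'n::finite)) = cmod c * norm z"
  by (simp add: norm_vec_def L2_set_right_distrib norm_mult)

lemma scaleR_eq_scale_vec: "r *\<^sub>R v = complex_of_real r *s (v :: complex ^ 'n::finite)"
  unfolding vec_eq_iff vector_scaleR_component vector_smult_component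
  unfolding scaleR_conv_of_real by simp

lemma cdot_ball_ne_1:
  assumes "norm z < 1" "norm b < 1"
  shows "cdot z b \<noteq> 1"
proof
  assume "cdot z b = 1"
  then have "1 \<le> norm z * norm b" using norm_cdot_le[of z b] by simp
  moreover have "norm z * norm b < 1 * 1"
    using assms by (intro mult_strict_mono') auto
  ultimately show False by simp
qed

section \<open>Moebius involutions of the ball\<close>

definition contraction :: "complex ^ 'n::finite \<Rightarrow> complex" where
  "contraction b = of_real (sqrt (1 - (norm b)\<^sup>2))"

text \<open>
  The usual formula for the automorphism exchanging \<open>0\<close> and \<open>b\<close> is
  \<open>(b - P z - s Q z) / (1 - \<langle>z, b\<rangle>)\<close>, where \<open>s = sqrt (1 - |b|\<^sup>2)\<close>, \<open>P\<close> is the orthogonal projection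
  onto \<open>\<complex> b\<close> and \<open>Q = 1 - P\<close>. Substituting \<open>P z = (\<langle>z, b\<rangle> / |b|\<^sup>2) b\<close> and
  \<open>(1 - s) / |b|\<^sup>2 = 1 / (1 + s)\<close> removes the division by \<open>|b|\<^sup>2\<close>, so that \<open>b = 0\<close> is no special case.
\<close>

definition ball_involution :: "complex ^ 'n::finite \<Rightarrow> complex ^ 'n \<Rightarrow> complex ^ 'n" where
  "ball_involution b z = (1 / (1 - cdot z b)) *s
     ((1 - cdot z b / (1 + contraction b)) *s b - contraction b *s z)"

lemma contraction_props:
  assumes "norm b < 1"
  shows "contraction b * contraction b = 1 - cdot b b" "contraction b \<noteq> 0" "1 + contraction b \<noteq> 0"
    "cnj (contraction b) = contraction b"
proof -
  have *: "(norm b)\<^sup>2 < 1" using assms by (simp add: power_less_one_iff abs_square_less_1)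
  then show "contraction b * contraction b = 1 - cdot b b"
    by (simp add: contraction_def cdot_self flip: of_real_mult)
  show "contraction b \<noteq> 0" using * by (simp add: contraction_def)
  have "1 + sqrt (1 - (norm b)\<^sup>2) > 0" using * by (simp add: add_pos_nonneg)
  then show "1 + contraction b \<noteq> 0" 
    unfolding contraction_def by (metis of_real_1 of_real_add of_real_eq_0_iff less_irrefl)
  show "cnj (contraction b) = contraction b" by (simp add: contraction_def)
qed

lemma cdot_ball_involution:
  assumes "norm b < 1" "cdot z b \<noteq> 1"
  shows "cdot (ball_involution b z) b = (cdot b b - cdot z b) / (1 - cdot z b)"
proof -
  define s where "s = contraction b"
  define c where "c = cdot z b"
  define t where "t = cdot b b"
  have s: "t = 1 - s * s" "s \<noteq> 0" "1 + s \<noteq> 0"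
    using contraction_props[OF assms(1)] by (auto simp: s_def t_def)
  have "(1 - c / (1 + s)) * t - s * c = t - c"
    using s(3) unfolding s(1) by (simp add: field_simps)
  then have "1 / (1 - c) * ((1 - c / (1 + s)) * t - s * c) = (t - c) / (1 - c)"
    by simp
  then show ?thesis
    unfolding ball_involution_def cdot_simps s_def c_def t_def .
qed

lemma ball_involution_twice:
  assumes "norm b < 1" "cdot z b \<noteq> 1"
  shows "ball_involution b (ball_involution b z) = z"
proof -
  define s where "s = contraction b"
  define c where "c = cdot z b"
  define t where "t = cdot b b"
  have s: "t = 1 - s * s" "s \<noteq> 0" "1 + s \<noteq> 0"
    using contraction_props[OF assms(1)] by (auto simp: s_def t_def)
  have c: "1 - c \<noteq> 0" using assms(2) by (simp add: c_def)
  have w: "cdot (ball_involution b z) b = (t - c) / (1 - c)"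
    using cdot_ball_involution[OF assms] by (simp add: c_def t_def)
  have d: "1 - (t - c) / (1 - c) = s * s / (1 - c)"
    using c unfolding s(1) by (simp add: field_simps)
  have e: "1 - (t - c) / (1 - c) / (1 + s) = s * (1 - c / (1 + s)) / (1 - c)"
    using c s(3) unfolding s(1) by (simp add: divide_simps) (simp add: algebra_simps)
  have expand: "s * k / (1 - c) * x - s * ((k * x - s * y) / (1 - c)) = s * s * y / (1 - c)" for k x y
    by (simp add: algebra_simps diff_divide_distrib)
  show ?thesis
  proof (subst vec_eq_iff, rule allI)
    fix i
    have m: "ball_involution b z $ i = ((1 - c / (1 + s)) * b $ i - s * z $ i) / (1 - c)"
      unfolding ball_involution_def s_def c_def vector_smult_component vector_minus_component by simp
    have "ball_involution b (ball_involution b z) $ i =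
      (s * (1 - c / (1 + s)) / (1 - c) * b $ i - s * (((1 - c / (1 + s)) * b $ i - s * z $ i) / (1 - c)))
        / (s * s / (1 - c))"
      unfolding ball_involution_def[of b "ball_involution b z"] vector_smult_component
        vector_minus_component w m s_def[symmetric] d e by simp
    also have "s * (1 - c / (1 + s)) / (1 - c) * b $ i
        - s * (((1 - c / (1 + s)) * b $ i - s * z $ i) / (1 - c)) = s * s * z $ i / (1 - c)"
      by (rule expand)
    also have "s * s * z $ i / (1 - c) / (s * s / (1 - c)) = z $ i"
      using s(2) c by simp
    finally show "ball_involution b (ball_involution b z) $ i = z $ i" .
  qed
qed

text \<open>
  Since \<open>1 - |b|\<^sup>2 > 0\<close>, the sign of \<open>1 - |z|\<^sup>2\<close> is preserved; this is why the involution maps the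
  ball to itself.
\<close>

lemma ball_involution_norm_identity:
  assumes "norm b < 1" "cdot z b \<noteq> 1"
  shows "(1 - (norm (ball_involution b z))\<^sup>2) * (cmod (1 - cdot z b))\<^sup>2 = (1 - (norm b)\<^sup>2) * (1 - (norm z)\<^sup>2)"
proof -
  define s where "s = contraction b"
  define c where "c = cdot z b"
  define t where "t = cdot b b"
  define n where "n = cdot z z"
  define k where "k = 1 - c / (1 + s)"
  define N where "N = k *s b - s *s z"
  have s: "t = 1 - s * s" "s \<noteq> 0" "1 + s \<noteq> 0" "cnj s = s"
    using contraction_props[OF assms(1)] by (auto simp: s_def t_def)
  have c: "1 - c \<noteq> 0" using assms(2) by (simp add: c_def)
  have "cdot N N = k * cnj k * t - k * s * cnj c - s * cnj k * c + s * s * n"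
    using s(4) cdot_commute[of b z] unfolding N_def cdot_simps t_def n_def c_def
    by (simp add: algebra_simps)
  moreover have "cnj (1 - c) = 1 - cnj c" by simp
  moreover define e where "e = 1 / (1 + s)"
  moreover have "e * (1 + s) = 1" "k = 1 - c * e" "cnj k = 1 - cnj c * e"
    using s(3) by (simp_all add: e_def k_def s(4))
  ultimately have "(1 - c) * cnj (1 - c) - cdot N N = (1 - t) * (1 - n)"
    using s(1) by algebra
  moreover have "norm N = norm (ball_involution b z) * cmod (1 - c)"
    using c unfolding ball_involution_def N_def k_def norm_scale_vec s_def c_def
    by (simp add: norm_divide)
  ultimately have "of_real ((cmod (1 - c))\<^sup>2 - (norm (ball_involution b z) * cmod (1 - c))\<^sup>2)
      = complex_of_real ((1 - (norm b)\<^sup>2) * (1 - (norm z)\<^sup>2))"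
    unfolding t_def n_def cdot_self complex_norm_square[symmetric] by simp
  then have "(cmod (1 - c))\<^sup>2 - (norm (ball_involution b z) * cmod (1 - c))\<^sup>2
      = (1 - (norm b)\<^sup>2) * (1 - (norm z)\<^sup>2)"
    using of_real_eq_iff by blast
  then show ?thesis by (simp add: c_def algebra_simps power_mult_distrib)
qed

lemma norm_ball_involution_less_1:
  assumes "norm b < 1" "norm z < 1"
  shows "norm (ball_involution b z) < 1"
proof -
  have "cdot z b \<noteq> 1" using cdot_ball_ne_1 assms by blast
  from ball_involution_norm_identity[OF assms(1) this]
  have "0 < (1 - (norm (ball_involution b z))\<^sup>2) * (cmod (1 - cdot z b))\<^sup>2"
    using assms by (simp add: power_less_one_iff abs_square_less_1)
  then have "(norm (ball_involution b z))\<^sup>2 < 1"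
    by (simp add: zero_less_mult_iff)
  then show ?thesis by (simp add: abs_square_less_1)
qed

lemma ball_involution_0: "ball_involution b 0 = b"
  by (simp add: ball_involution_def)

lemma ball_involution_center: "norm b < 1 \<Longrightarrow> ball_involution b b = 0"
  using ball_involution_twice[of b 0] by (simp add: ball_involution_0)

section \<open>Automorphisms of the ball\<close>

lemma bounded_linear_axis: "bounded_linear (axis i :: complex \<Rightarrow> complex ^ 'n::finite)"
  unfolding linear_conv_bounded_linear[symmetric]
  by (rule linearI) (auto simp: axis_def vec_eq_iff)

lemma has_derivative_vecI:
  fixes f :: "'a::real_normed_vector \<Rightarrow> complex ^ 'n::finite"
  assumes "\<And>i. ((\<lambda>x. f x $ i) has_derivative (\<lambda>h. f' h $ i)) F"
  shows "(f has_derivative f') F"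
proof -
  have *: "(\<Sum>i\<in>UNIV. axis i (v $ i)) = v" for v :: "complex ^ 'n"
    by (simp add: vec_eq_iff axis_def)
  have "((\<lambda>x. \<Sum>i\<in>UNIV. axis i (f x $ i)) has_derivative (\<lambda>h. \<Sum>i\<in>UNIV. axis i (f' h $ i))) F"
    by (intro has_derivative_sum bounded_linear.has_derivative[OF bounded_linear_axis] assms)
  then show ?thesis by (simp add: *)
qed

lemma bounded_linear_cdot_left: "bounded_linear (\<lambda>z. cdot z b)"
  unfolding cdot_def
  by (intro bounded_linear_sum bounded_linear_compose[OF bounded_linear_mult_left] bounded_linear_vec_nth)

lemma holomorphic_ball_involution:
  fixes b :: "complex ^ 'n::finite"
  assumes "norm b < 1"
  shows "holomorphic_map_on unit_ball (ball_involution b)"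
  unfolding holomorphic_map_on_def
proof
  fix z :: "complex ^ 'n" assume "z \<in> unit_ball"
  then have ne: "cdot z b \<noteq> 1" using cdot_ball_ne_1 assms by simp
  then have ne': "1 - cdot z b \<noteq> 0" by simp
  define s where "s = contraction b"
  define D where "D h = (1 / (1 - cdot z b)) *s (- (cdot h b / (1 + s)) *s b - s *s h)
    + (cdot h b / (1 - cdot z b)\<^sup>2) *s ((1 - cdot z b / (1 + s)) *s b - s *s z)" for h
  have cd: "((\<lambda>z. cdot z b) has_derivative (\<lambda>h. cdot h b)) (at z within S)" for S
    by (rule bounded_linear_imp_has_derivative[OF bounded_linear_cdot_left])
  have nd: "((\<lambda>z. z $ i) has_derivative (\<lambda>h. h $ i)) (at z within S)" for S i
    by (rule bounded_linear_imp_has_derivative[OF bounded_linear_vec_nth])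
  have "(ball_involution b has_derivative D) (at z within unit_ball)"
  proof (rule has_derivative_vecI)
    fix i
    have num: "((\<lambda>z. (1 - cdot z b / (1 + s)) * b $ i - s * z $ i) has_derivative
        (\<lambda>h. - (cdot h b / (1 + s)) * b $ i - s * h $ i)) (at z within unit_ball)"
      unfolding divide_inverse by (rule derivative_eq_intros cd nd refl)+ simp
    have den: "((\<lambda>z. 1 - cdot z b) has_derivative (\<lambda>h. - cdot h b)) (at z within unit_ball)"
      by (rule derivative_eq_intros cd refl)+ simp
    have "((\<lambda>z. ((1 - cdot z b / (1 + s)) * b $ i - s * z $ i) / (1 - cdot z b)) has_derivative
        (\<lambda>h. D h $ i)) (at z within unit_ball)"
    proof (rule has_derivative_eq_rhs[OF has_derivative_divide'[OF num den]])
      have quotient: "(n' * y - n * - y') / (y * y) = 1 / y * n' + y' / y\<^sup>2 * n"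
        if "y \<noteq> 0" for n n' y y' :: complex
        using that by (simp add: field_simps power2_eq_square)
      show "(\<lambda>h. ((- (cdot h b / (1 + s)) * b $ i - s * h $ i) * (1 - cdot z b)
            - ((1 - cdot z b / (1 + s)) * b $ i - s * z $ i) * - cdot h b)
          / ((1 - cdot z b) * (1 - cdot z b))) = (\<lambda>h. D h $ i)"
        unfolding quotient[OF ne'] D_def vector_add_component vector_minus_component
          vector_smult_component ..
    qed (use ne in simp)
    then show "((\<lambda>z. ball_involution b z $ i) has_derivative (\<lambda>h. D h $ i)) (at z within unit_ball)"
      unfolding ball_involution_def vector_smult_component vector_minus_component s_def by simp
  qed
  moreover have "Vector_Spaces.linear (*s) (*s) D"
    by (rule Vector_Spaces.linear_iff[THEN iffD2])
      (auto simp: D_def vec_eq_iff cdot_simps vec.vector_space_axioms algebra_simps add_divide_distrib)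
  then have "D = (\<lambda>h. matrix D *v h)"
    by (simp add: fun_eq_iff matrix_works)
  ultimately show "\<exists>A. (ball_involution b has_derivative (\<lambda>h. A *v h)) (at z within unit_ball)"
    by metis
qed

lemma holomorphic_map_on_compose:
  assumes "holomorphic_map_on S f" "f ` S \<subseteq> T" "holomorphic_map_on T g"
  shows "holomorphic_map_on S (\<lambda>z. g (f z))"
  unfolding holomorphic_map_on_def
proof
  fix z assume z: "z \<in> S"
  obtain A where A: "(f has_derivative (\<lambda>h. A *v h)) (at z within S)"
    using assms(1) z by (auto simp: holomorphic_map_on_def)
  obtain B where "(g has_derivative (\<lambda>h. B *v h)) (at (f z) within T)"
    using assms(2,3) z by (auto simp: holomorphic_map_on_def)
  then have "(g has_derivative (\<lambda>h. B *v h)) (at (f z) within f ` S)"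
    using assms(2) by (rule has_derivative_subset)
  from diff_chain_within[OF A this]
  have "((\<lambda>z. g (f z)) has_derivative (\<lambda>h. (B ** A) *v h)) (at z within S)"
    by (simp add: o_def matrix_vector_mul_assoc)
  then show "\<exists>A. ((\<lambda>z. g (f z)) has_derivative (\<lambda>h. A *v h)) (at z within S)" by blast
qed

lemma scale_curve_has_derivative:
  "((\<lambda>\<zeta>. \<zeta> *s (u :: complex ^ 'n::finite)) has_derivative (\<lambda>k. k *s u)) F"
  by (rule has_derivative_vecI, simp)
    (rule bounded_linear_imp_has_derivative[OF bounded_linear_mult_left])

text \<open>
  Slices reduce the Schwarz lemma in several variables to the one in the unit disc: \<open>g\<close> is
  restricted to a complex line through the origin, and then one coordinate of its value, in an
  arbitrary direction \<open>w\<close>, is taken.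
\<close>

lemma holomorphic_slice:
  fixes g :: "complex ^ 'n::finite \<Rightarrow> complex ^ 'n"
  assumes "holomorphic_map_on unit_ball g" "norm u \<le> 1"
  shows "(\<lambda>\<zeta>. cdot (g (\<zeta> *s u)) w) holomorphic_on ball 0 1"
  unfolding holomorphic_on_def
proof
  fix \<zeta> :: complex assume z: "\<zeta> \<in> ball 0 1"
  have "cmod \<zeta> * norm u \<le> cmod \<zeta> * 1" using assms(2) by (intro mult_left_mono) auto
  then have b: "\<zeta> *s u \<in> unit_ball" using z by (simp add: norm_scale_vec)
  then obtain A where "(g has_derivative (\<lambda>h. A *v h)) (at (\<zeta> *s u))"
    using assms(1) at_within_open[OF b open_ball] unfolding holomorphic_map_on_def by metis
  from diff_chain_at[OF scale_curve_has_derivative this]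
  have "((\<lambda>\<zeta>. g (\<zeta> *s u)) has_derivative (\<lambda>k. A *v (k *s u))) (at \<zeta>)"
    by (simp add: o_def)
  from bounded_linear.has_derivative[OF bounded_linear_cdot_left this]
  have "((\<lambda>\<zeta>. cdot (g (\<zeta> *s u)) w) has_derivative (\<lambda>k. cdot (A *v (k *s u)) w)) (at \<zeta>)" .
  moreover have "(\<lambda>k. cdot (A *v (k *s u)) w) = (*) (cdot (A *v u) w)"
    by (simp add: fun_eq_iff vector_scalar_commute cdot_scale_left mult.commute)
  ultimately have "((\<lambda>\<zeta>. cdot (g (\<zeta> *s u)) w) has_field_derivative cdot (A *v u) w) (at \<zeta>)"
    by (simp add: has_field_derivative_def)
  then show "(\<lambda>\<zeta>. cdot (g (\<zeta> *s u)) w) field_differentiable at \<zeta> within ball 0 1"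
    using field_differentiable_at_within field_differentiable_def by blast
qed

lemma unit_vector_slice:
  fixes z :: "complex ^ 'n::finite"
  assumes "z \<noteq> 0"
  shows "norm (of_real (1 / norm z) *s z) = 1" "of_real (norm z) *s (of_real (1 / norm z) *s z) = z"
  using assms by (auto simp: norm_scale_vec vec_eq_iff norm_divide)

lemma slice_bound:
  fixes g :: "complex ^ 'n::finite \<Rightarrow> complex ^ 'n"
  assumes "g ` unit_ball \<subseteq> unit_ball" "norm u = 1" "norm w = 1" "cmod \<zeta> < 1"
  shows "cmod (cdot (g (\<zeta> *s u)) w) < 1"
proof -
  have "\<zeta> *s u \<in> unit_ball" using assms by (simp add: norm_scale_vec)
  then have "norm (g (\<zeta> *s u)) < 1" using assms(1) by (auto simp: subset_iff)
  then show ?thesis using norm_cdot_le[of "g (\<zeta> *s u)" w] assms(3) by simp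
qed

text \<open>
  The slice in the direction of \<open>z\<close>, measured in the direction of \<open>g z\<close>, maps \<open>|z|\<close> to \<open>|g z|\<close>, so
  the Schwarz lemma in the disc applies.
\<close>

lemma schwarz_norm_le:
  fixes g :: "complex ^ 'n::finite \<Rightarrow> complex ^ 'n"
  assumes g: "holomorphic_map_on unit_ball g" "g ` unit_ball \<subseteq> unit_ball" "g 0 = 0"
    and z: "norm z < 1"
  shows "norm (g z) \<le> norm z"
proof (cases "z = 0 \<or> g z = 0")
  case True
  then show ?thesis using g(3) by auto
next
  case False
  define u where "u = of_real (1 / norm z) *s z"
  define w where "w = of_real (1 / norm (g z)) *s g z"
  have u: "norm u = 1" "of_real (norm z) *s u = z" 
    using unit_vector_slice[of z] False by (auto simp: u_def)
  have w: "norm w = 1" using unit_vector_slice[of "g z"] False by (auto simp: w_def)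
  have "cmod (cdot (g (of_real (norm z) *s u)) w) \<le> cmod (of_real (norm z))"
    by (rule Schwarz_Lemma(1)[of "\<lambda>\<zeta>. cdot (g (\<zeta> *s u)) w"])
      (use holomorphic_slice[OF g(1)] slice_bound[OF g(2) u(1) w] u g(3) z in auto)
  moreover have "cdot (g z) w = of_real (norm (g z))"
    using False by (simp add: w_def cdot_scale_right cdot_self power2_eq_square)
  ultimately show ?thesis by (simp add: u(2))
qed

text \<open>
  With \<open>u = z / |z|\<close> and \<open>w = g z / |g z|\<close>, the function \<open>\<zeta> \<mapsto> \<langle>g (\<zeta> u), w\<rangle>\<close> attains equality in the
  Schwarz lemma at \<open>\<zeta> = |z|\<close>, so it is \<open>\<zeta> \<mapsto> \<zeta>\<close>. Thus the component of \<open>g (\<zeta> u)\<close> along \<open>w\<close> already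
  has the full length \<open>|\<zeta>| = |g (\<zeta> u)|\<close>, which leaves no room for any other component:
  \<open>g (\<zeta> u) = \<zeta> w\<close>.
\<close>

lemma isometric_slice_linear:
  fixes g :: "complex ^ 'n::finite \<Rightarrow> complex ^ 'n"
  assumes g: "holomorphic_map_on unit_ball g" "g ` unit_ball \<subseteq> unit_ball" "g 0 = 0"
    and iso: "\<And>z. norm z < 1 \<Longrightarrow> norm (g z) = norm z"
    and z: "norm z < 1" and t: "0 < t" "t < 1"
  shows "g (of_real t *s z) = of_real t *s g z"
proof (cases "z = 0")
  case True
  then show ?thesis using g(3) by auto
next
  case False
  then have gz: "g z \<noteq> 0" using iso[OF z] by auto
  define u where "u = of_real (1 / norm z) *s z"
  define w where "w = of_real (1 / norm (g z)) *s g z"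
  have u: "norm u = 1" "of_real (norm z) *s u = z" 
    using unit_vector_slice[of z] False by (auto simp: u_def)
  have w: "norm w = 1" "of_real (norm (g z)) *s w = g z"
    using unit_vector_slice[of "g z"] gz by (auto simp: w_def)
  have gw: "cdot (g z) w = of_real (norm (g z))"
    using gz by (simp add: w_def cdot_scale_right cdot_self power2_eq_square)
  have "\<exists>\<alpha>. (\<forall>\<zeta>. cmod \<zeta> < 1 \<longrightarrow> cdot (g (\<zeta> *s u)) w = \<alpha> * \<zeta>) \<and> cmod \<alpha> = 1"
  proof (rule Schwarz_Lemma(3))
    show "(\<lambda>\<zeta>. cdot (g (\<zeta> *s u)) w) holomorphic_on ball 0 1"
      using holomorphic_slice[OF g(1)] u by simp
    show "cdot (g (0 *s u)) w = 0" using g(3) by simp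
    show "cmod (0 :: complex) < 1" by simp
    show "cmod (cdot (g (\<zeta> *s u)) w) < 1" if "cmod \<zeta> < 1" for \<zeta>
      using slice_bound[OF g(2) u(1) w(1) that] .
    show "(\<exists>\<zeta>. cmod \<zeta> < 1 \<and> \<zeta> \<noteq> 0 \<and> cmod (cdot (g (\<zeta> *s u)) w) = cmod \<zeta>) \<or>
        cmod (deriv (\<lambda>\<zeta>. cdot (g (\<zeta> *s u)) w) 0) = 1"
      by (intro disjI1 exI[of _ "of_real (norm z)"]) (use u gw z False iso in auto)
  qed
  then obtain \<alpha> where \<alpha>: "\<And>\<zeta>. cmod \<zeta> < 1 \<Longrightarrow> cdot (g (\<zeta> *s u)) w = \<alpha> * \<zeta>" by auto
  have "\<alpha> = 1" using \<alpha>[of "of_real (norm z)"] u(2) z gw iso[OF z] False by simp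
  define r where "r = complex_of_real (t * norm z)"
  have "t * norm z < 1 * 1" using z t by (intro mult_strict_mono') auto
  then have r: "cmod r < 1" "cnj r = r" using t by (auto simp: r_def norm_mult)
  have ru: "of_real t *s z = r *s u" unfolding r_def by (subst u(2)[symmetric]) (simp add: vec_eq_iff)
  define y where "y = g (r *s u)"
  have yw: "cdot y w = r" using \<alpha>[OF r(1)] \<open>\<alpha> = 1\<close> by (simp add: y_def)
  moreover have "cdot y y = r * r"
  proof -
    have "norm y = cmod r" using iso[of "r *s u"] r u by (simp add: y_def norm_scale_vec)
    then show ?thesis using t by (simp add: cdot_self r_def norm_mult power2_eq_square)
  qed
  moreover have "cdot w w = 1" using w by (simp add: cdot_self)
  ultimately have "cdot (y - r *s w) (y - r *s w) = 0"
    using r(2) cdot_commute[of w y] by (simp add: cdot_simps algebra_simps)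
  then have "y = r *s w" by (simp add: cdot_self)
  moreover have "r *s w = of_real t *s g z"
    unfolding r_def by (subst w(2)[symmetric]) (simp add: vec_eq_iff iso[OF z])
  ultimately show ?thesis by (simp add: ru y_def)
qed

text \<open>
  A map that is differentiable at \<open>0\<close> and commutes with real scalings equals its derivative at \<open>0\<close>.
\<close>

lemma isometric_holomorphic_linear:
  fixes g :: "complex ^ 'n::finite \<Rightarrow> complex ^ 'n"
  assumes g: "holomorphic_map_on unit_ball g" "g ` unit_ball \<subseteq> unit_ball" "g 0 = 0"
    and iso: "\<And>z. norm z < 1 \<Longrightarrow> norm (g z) = norm z"
  obtains A where "\<And>z. norm z < 1 \<Longrightarrow> g z = A *v z"
proof -
  have 0: "0 \<in> (unit_ball :: (complex ^ 'n) set)" by simp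
  obtain A where A: "(g has_derivative (\<lambda>h. A *v h)) (at 0)"
    using g(1) 0 at_within_open[OF 0 open_ball] unfolding holomorphic_map_on_def by metis
  have "g z = A *v z" if z: "norm z < 1" for z
  proof -
    have scale: "complex_of_real t *s v = t *\<^sub>R v" for t and v :: "complex ^ 'n"
      by (rule scaleR_eq_scale_vec[symmetric])
    have c: "((\<lambda>t. t *\<^sub>R z) has_derivative (\<lambda>t. t *\<^sub>R z)) (at 0 within {0..1/2})"
      by (intro bounded_linear_imp_has_derivative bounded_linear_scaleR_left)
    have "(g has_derivative (\<lambda>h. A *v h)) (at (0 *\<^sub>R z) within (\<lambda>t. t *\<^sub>R z) ` {0..1/2})"
      using has_derivative_at_withinI[OF A] by simp
    from diff_chain_within[OF c this]
    have 1: "((\<lambda>t. g (t *\<^sub>R z)) has_derivative (\<lambda>t. A *v (t *\<^sub>R z))) (at 0 within {0..1/2})"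
      by (simp add: o_def)
    have 2: "((\<lambda>t. g (t *\<^sub>R z)) has_derivative (\<lambda>t. t *\<^sub>R g z)) (at 0 within {0..1/2})"
    proof (rule has_derivative_transform_within[where d = 1 and f = "\<lambda>t. t *\<^sub>R g z"])
      show "((\<lambda>t. t *\<^sub>R g z) has_derivative (\<lambda>t. t *\<^sub>R g z)) (at 0 within {0..1/2})"
        by (intro bounded_linear_imp_has_derivative bounded_linear_scaleR_left)
      show "t *\<^sub>R g z = g (t *\<^sub>R z)" if "t \<in> {0..1/2}" for t
        using isometric_slice_linear[OF g iso z, of t] that g(3) by (cases "t = 0") (auto simp: scale)
    qed auto
    \<comment> \<open>both sides are the one-sided derivative at \<open>0\<close> of \<open>t \<mapsto> g (t z)\<close>\<close>
    have nt: "at (0::real) within {0..1/2} \<noteq> bot"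
      using trivial_limit_at_right_real[of 0] by (simp add: at_within_Icc_at_right)
    have "A *v (t *\<^sub>R z) = t *\<^sub>R (A *v z)" for t
      unfolding scale[symmetric] by (simp add: vector_scalar_commute)
    then show ?thesis
      using vector_derivative_unique_within[OF nt] 1 2 unfolding has_vector_derivative_def by simp
  qed
  then show ?thesis by (rule that)
qed

text \<open>
  Composing \<open>\<gamma>\<close> with the involution that exchanges \<open>0\<close> and \<open>b = \<gamma>\<^sup>-\<^sup>1 0\<close> gives an automorphism fixing
  \<open>0\<close>. The Schwarz lemma for it and for its inverse makes it norm preserving, hence linear.
\<close>

lemma ball_aut_factorization:
  fixes \<gamma> :: "complex ^ 'n::finite \<Rightarrow> complex ^ 'n"
  assumes "\<gamma> \<in> ball_aut"
  obtains b A where "norm b < 1" "\<gamma> b = 0" "surj ((*v) A)"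
    "\<And>z. norm z < 1 \<Longrightarrow> \<gamma> z = A *v ball_involution b z"
proof -
  define \<delta> where "\<delta> = inv_into unit_ball \<gamma>"
  have bij: "bij_betw \<gamma> unit_ball unit_ball"
    and hol: "holomorphic_map_on unit_ball \<gamma>" "holomorphic_map_on unit_ball \<delta>"
    using assms by (auto simp: ball_aut_def \<delta>_def)
  have \<gamma>: "norm (\<gamma> z) < 1" if "norm z < 1" for z
    using bij_betwE[OF bij] that by auto
  have \<delta>: "norm (\<delta> z) < 1" "\<gamma> (\<delta> z) = z" if "norm z < 1" for z
    using bij_betwE[OF bij_betw_inv_into[OF bij]] bij_betw_inv_into_right[OF bij] that
    by (auto simp: \<delta>_def)
  have \<delta>\<gamma>: "\<delta> (\<gamma> z) = z" if "norm z < 1" for z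
    using bij_betw_inv_into_left[OF bij] that by (auto simp: \<delta>_def)
  define b where "b = \<delta> 0"
  have b: "norm b < 1" "\<gamma> b = 0" using \<delta>[of 0] by (auto simp: b_def)
  have inv: "ball_involution b (ball_involution b z) = z" if "norm z < 1" for z
    using ball_involution_twice[OF b(1) cdot_ball_ne_1[OF that b(1)]] .
  have nb: "norm (ball_involution b z) < 1" if "norm z < 1" for z
    using norm_ball_involution_less_1[OF b(1) that] .
  define g where "g z = \<gamma> (ball_involution b z)" for z
  define k where "k z = ball_involution b (\<delta> z)" for z
  have g: "holomorphic_map_on unit_ball g" "g ` unit_ball \<subseteq> unit_ball" "g 0 = 0"
    unfolding g_def
    by (rule holomorphic_map_on_compose[OF holomorphic_ball_involution[OF b(1)] _ hol(1)])
      (auto simp: nb \<gamma> b ball_involution_0)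
  have k: "holomorphic_map_on unit_ball k" "k ` unit_ball \<subseteq> unit_ball" "k 0 = 0"
    unfolding k_def
    by (rule holomorphic_map_on_compose[OF hol(2) _ holomorphic_ball_involution[OF b(1)]])
      (auto simp: nb \<delta> b(1) ball_involution_center simp flip: b_def)
  have "norm (g z) = norm z" if z: "norm z < 1" for z
  proof (rule antisym)
    show "norm (g z) \<le> norm z" by (rule schwarz_norm_le[OF g z])
    have "k (g z) = z" using z by (simp add: k_def g_def \<delta>\<gamma> nb inv)
    then show "norm z \<le> norm (g z)"
      using schwarz_norm_le[OF k, of "g z"] \<gamma>[OF nb[OF z]] by (simp add: g_def)
  qed
  then obtain A where A: "\<And>z. norm z < 1 \<Longrightarrow> g z = A *v z"
    using isometric_holomorphic_linear[OF g] by blast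
  have form: "\<gamma> z = A *v ball_involution b z" if "norm z < 1" for z
    using A[OF nb[OF that]] by (simp add: g_def inv that)
  have "surj ((*v) A)"
    unfolding surj_def
  proof
    fix y :: "complex ^ 'n"
    define r where "r = complex_of_real (1 / (1 + norm y))"
    have "1 + norm y > 0" by (simp add: add_pos_nonneg)
    then have r: "r \<noteq> 0" "norm (r *s y) < 1"
      unfolding norm_scale_vec r_def of_real_eq_0_iff norm_of_real by (simp_all)
    have "r *s y = A *v ball_involution b (\<delta> (r *s y))"
      using form \<delta> r(2) by metis
    then have "inverse r *s (r *s y) = A *v (inverse r *s ball_involution b (\<delta> (r *s y)))"
      by (simp add: vector_scalar_commute)
    then show "\<exists>x. y = A *v x" using r(1) by auto
  qed
  with b form show ?thesis using that by blast
qed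

section \<open>Polynomials in several variables\<close>

definition total_degree :: "nat ^ 'n::finite \<Rightarrow> nat" where
  "total_degree \<alpha> = (\<Sum>j\<in>UNIV. \<alpha> $ j)"

definition poly_val :: "(nat ^ 'n::finite) set \<Rightarrow> (nat ^ 'n \<Rightarrow> complex) \<Rightarrow> complex ^ 'n \<Rightarrow> complex" where
  "poly_val S c z = (\<Sum>\<alpha>\<in>S. c \<alpha> * monomial_val \<alpha> z)"

lemma monomial_val_scale: "monomial_val \<alpha> (c *s v) = c ^ total_degree \<alpha> * monomial_val \<alpha> v"
  by (simp add: monomial_val_def total_degree_def power_mult_distrib prod.distrib power_sum)

text \<open>
  The monomial with exponent \<open>\<alpha>\<close> restricted to the parametrized line \<open>t \<mapsto> x + t y\<close>.
\<close>

definition affine_monom :: "nat ^ 'n::finite \<Rightarrow> complex ^ 'n \<Rightarrow> complex ^ 'n \<Rightarrow> complex poly" where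
  "affine_monom \<alpha> x y = (\<Prod>j\<in>UNIV. [:x $ j, y $ j:] ^ (\<alpha> $ j))"

lemma poly_affine_monom: "poly (affine_monom \<alpha> x y) t = monomial_val \<alpha> (x + t *s y)"
  by (simp add: affine_monom_def monomial_val_def poly_prod)

lemma degree_affine_monom: "degree (affine_monom \<alpha> x y) \<le> total_degree \<alpha>"
proof -
  have "degree (affine_monom \<alpha> x y) \<le> (\<Sum>j\<in>UNIV. degree ([:x $ j, y $ j:] ^ (\<alpha> $ j)))"
    unfolding affine_monom_def using degree_prod_sum_le[OF finite, of "\<lambda>j. [:x $ j, y $ j:] ^ (\<alpha> $ j)" UNIV]
    by (simp add: o_def)
  also have "\<dots> \<le> (\<Sum>j\<in>UNIV. \<alpha> $ j)"
  proof (rule sum_mono)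
    fix j
    have "degree ([:x $ j, y $ j:] ^ (\<alpha> $ j)) \<le> degree [:x $ j, y $ j:] * \<alpha> $ j"
      by (rule degree_power_le)
    also have "\<dots> \<le> 1 * \<alpha> $ j" by (intro mult_right_mono) auto
    finally show "degree ([:x $ j, y $ j:] ^ (\<alpha> $ j)) \<le> \<alpha> $ j" by simp
  qed
  finally show ?thesis by (simp add: total_degree_def)
qed

definition affine_restriction ::
    "(nat ^ 'n::finite) set \<Rightarrow> (nat ^ 'n \<Rightarrow> complex) \<Rightarrow> complex ^ 'n \<Rightarrow> complex ^ 'n \<Rightarrow> complex poly" where
  "affine_restriction S c x y = (\<Sum>\<alpha>\<in>S. smult (c \<alpha>) (affine_monom \<alpha> x y))"

lemma poly_affine_restriction: "poly (affine_restriction S c x y) t = poly_val S c (x + t *s y)"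
  by (simp add: affine_restriction_def poly_val_def poly_sum poly_affine_monom)

lemma degree_affine_restriction:
  assumes "finite S" "\<And>\<alpha>. \<alpha> \<in> S \<Longrightarrow> total_degree \<alpha> \<le> d"
  shows "degree (affine_restriction S c x y) \<le> d"
  unfolding affine_restriction_def
  by (intro degree_sum_le assms(1) order_trans[OF degree_smult_le] order_trans[OF degree_affine_monom] assms(2))

lemma monomial_val_axis:
  "monomial_val \<alpha> (t *s axis j 1) = (if \<alpha> = axis j (\<alpha> $ j) then t ^ (\<alpha> $ j) else 0)"
proof (cases "\<alpha> = axis j (\<alpha> $ j)")
  case True
  have "(t *s axis j 1 :: complex ^ 'a) $ i ^ (\<alpha> $ i) = (if i = j then t ^ (\<alpha> $ j) else 1)" for i
    by (subst True) (simp add: axis_def)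
  then have "monomial_val \<alpha> (t *s axis j 1) = t ^ (\<alpha> $ j)"
    unfolding monomial_val_def by simp
  then show ?thesis using True by simp
next
  case False
  then obtain i where "i \<noteq> j" "\<alpha> $ i \<noteq> 0"
    by (auto simp: vec_eq_iff axis_def split: if_splits)
  then have "(t *s axis j 1 :: complex ^ 'a) $ i ^ (\<alpha> $ i) = 0" by (simp add: axis_def)
  then have "monomial_val \<alpha> (t *s axis j 1) = 0"
    unfolding monomial_val_def by (intro prod_zero) auto
  then show ?thesis using False by simp
qed

text \<open>
  With the weights \<open>1, M, M\<^sup>2, \<dots>\<close>, two distinct exponent vectors get the same weighted sum only if \<open>M\<close>
  is a root of the nonzero integer polynomial whose coefficients are the differences of the two
  vectors. Finitely many pairs exclude only finitely many \<open>M\<close>.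
\<close>

lemma separating_weights:
  fixes S :: "(nat ^ 'n::finite) set"
  assumes "finite S"
  obtains w :: "'n \<Rightarrow> nat" where "inj_on (\<lambda>\<alpha>. \<Sum>j\<in>UNIV. w j * \<alpha> $ j) S"
proof -
  obtain e :: "'n \<Rightarrow> nat" where e: "inj e"
    using finite_imp_inj_to_nat_seg[OF finite_class.finite_UNIV] by blast
  define P where "P \<alpha> \<beta> = (\<Sum>j\<in>UNIV. monom (int (\<alpha> $ j) - int (\<beta> $ j)) (e j))" for \<alpha> \<beta> :: "nat ^ 'n"
  have P0: "P \<alpha> \<beta> \<noteq> 0" if ne: "\<alpha> \<noteq> \<beta>" for \<alpha> \<beta>
  proof -
    obtain i where i: "\<alpha> $ i \<noteq> \<beta> $ i" using ne by (auto simp: vec_eq_iff)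
    have "coeff (P \<alpha> \<beta>) (e i) = (\<Sum>j\<in>UNIV. if j = i then int (\<alpha> $ j) - int (\<beta> $ j) else 0)"
      unfolding P_def coeff_sum coeff_monom by (rule sum.cong) (auto simp: inj_eq[OF e])
    then have "coeff (P \<alpha> \<beta>) (e i) \<noteq> 0" using i by simp
    then show ?thesis by auto
  qed
  define B where "B = (\<Union>(\<alpha>, \<beta>)\<in>S \<times> S - Id. {x. poly (P \<alpha> \<beta>) x = 0})"
  have "finite B"
    unfolding B_def using assms P0 by (auto intro!: poly_roots_finite)
  then have "\<not> range int \<subseteq> B"
    using finite_subset infinite_UNIV_nat finite_imageD[OF _ inj_of_nat] by blast
  then obtain M where M: "int M \<notin> B" by blast
  have "inj_on (\<lambda>\<alpha>. \<Sum>j\<in>UNIV. M ^ e j * \<alpha> $ j) S"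
  proof (rule inj_onI, rule ccontr)
    fix \<alpha> \<beta> assume *: "\<alpha> \<in> S" "\<beta> \<in> S" "\<alpha> \<noteq> \<beta>"
      and "(\<Sum>j\<in>UNIV. M ^ e j * \<alpha> $ j) = (\<Sum>j\<in>UNIV. M ^ e j * \<beta> $ j)"
    then have "int (\<Sum>j\<in>UNIV. M ^ e j * \<alpha> $ j) = int (\<Sum>j\<in>UNIV. M ^ e j * \<beta> $ j)" by simp
    then have "poly (P \<alpha> \<beta>) (int M) = 0"
      by (simp add: P_def poly_sum poly_monom algebra_simps sum_subtractf)
    with * M show False by (auto simp: B_def)
  qed
  then show ?thesis by (rule that)
qed

text \<open>
  Substituting \<open>t\<^bsup>w j\<^esup>\<close> for the \<open>j\<close>-th variable, with separating weights \<open>w\<close>, sends distinct monomials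
  to distinct powers of \<open>t\<close>, so no coefficients can cancel (Kronecker substitution).
\<close>

lemma poly_val_nonzero:
  fixes S :: "(nat ^ 'n::finite) set"
  assumes "finite S" "\<alpha>\<^sub>0 \<in> S" "c \<alpha>\<^sub>0 \<noteq> 0"
  obtains y where "poly_val S c y \<noteq> 0"
proof -
  obtain w :: "'n \<Rightarrow> nat" where w: "inj_on (\<lambda>\<alpha>. \<Sum>j\<in>UNIV. w j * \<alpha> $ j) S"
    using separating_weights[OF assms(1)] .
  define W where "W \<alpha> = (\<Sum>j\<in>UNIV. w j * \<alpha> $ j)" for \<alpha> :: "nat ^ 'n"
  define p where "p = (\<Sum>\<alpha>\<in>S. monom (c \<alpha>) (W \<alpha>))"
  have "coeff p (W \<alpha>\<^sub>0) = (\<Sum>\<alpha>\<in>S. if \<alpha> = \<alpha>\<^sub>0 then c \<alpha> else 0)"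
    unfolding p_def coeff_sum coeff_monom
    using inj_onD[OF w _ _ assms(2)] by (intro sum.cong) (auto simp: W_def)
  then have "p \<noteq> 0" using assms by auto
  then obtain t where t: "poly p t \<noteq> 0" using poly_all_0_iff_0 by blast
  have "monomial_val \<alpha> (\<chi> j. t ^ w j) = t ^ W \<alpha>" for \<alpha>
    by (simp add: monomial_val_def W_def power_sum power_mult)
  then have "poly_val S c (\<chi> j. t ^ w j) = poly p t"
    by (simp add: poly_val_def p_def poly_sum poly_monom)
  with t show ?thesis using that[of "\<chi> j. t ^ w j"] by simp
qed

lemma poly_eq_near_0:
  fixes p q :: "complex poly"
  assumes "\<epsilon> > 0" "\<And>x. cmod x < \<epsilon> \<Longrightarrow> poly p x = poly q x"
  shows "p = q"
proof (rule ccontr)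
  assume "p \<noteq> q"
  then have "finite {x. poly (p - q) x = 0}" by (intro poly_roots_finite) simp
  moreover have "ball 0 \<epsilon> \<subseteq> {x. poly (p - q) x = 0}" using assms(2) by auto
  moreover have "infinite (ball (0::complex) \<epsilon>)"
    using assms(1) uncountable_ball countable_finite by blast
  ultimately show False using finite_subset by blast
qed

text \<open>
  All \<open>d\<close> zeros that \<open>(1 - m x)\<^sup>d\<close> contributes at \<open>1 / m\<close> must be zeros of \<open>H\<close>, because \<open>P\<close> has none
  there; this exhausts the degree of \<open>H\<close>, which is therefore a constant multiple of \<open>(1 - m x)\<^sup>d\<close>.
\<close>

lemma linear_power_cofactor:
  fixes P H R :: "complex poly"
  assumes eq: "P * H = [:1, - m:] ^ d * R" and m: "m \<noteq> 0"
    and P: "poly P (1 / m) \<noteq> 0" and deg: "degree H \<le> d"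
  shows "poly H x = poly H 0 * (1 - x * m) ^ d"
proof (cases "H = 0")
  case False
  have lin: "[:1, - m:] = smult (- m) [:- (1 / m), 1:]" using m by simp
  have P0: "P \<noteq> 0" using P by auto
  have "[:- (1 / m), 1:] ^ d dvd [:1, - m:] ^ d"
    unfolding lin smult_power by (rule dvd_smult) simp
  then have "[:- (1 / m), 1:] ^ d dvd P * H" unfolding eq by simp
  then have "d \<le> order (1 / m) (P * H)" using False P0 by (auto simp: order_divides)
  also have "order (1 / m) (P * H) = order (1 / m) H"
    using P False P0 order_root[of P] by (subst order_mult) auto
  finally have "[:- (1 / m), 1:] ^ d dvd H" using order_divides by blast
  then obtain K where K: "H = [:- (1 / m), 1:] ^ d * K" by (auto simp: dvd_def)
  have "degree H = d + degree K"
    using False unfolding K by (subst degree_mult_eq) (auto simp: degree_power_eq)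
  then obtain k where k: "K = [:k:]" using deg by (metis add_le_same_cancel1 degree_eq_zeroE le_zero_eq)
  have H0: "poly H 0 = (- (1 / m)) ^ d * k" by (simp add: K k)
  have "poly H 0 * (1 - x * m) ^ d = (- (1 / m) * (1 - x * m)) ^ d * k"
    unfolding H0 power_mult_distrib by (simp only: mult_ac)
  also have "- (1 / m) * (1 - x * m) = - (1 / m) + x" using m by (simp add: field_simps)
  also have "(- (1 / m) + x) ^ d * k = poly H x" by (simp add: K k)
  finally show ?thesis ..
qed simp

section \<open>The denominator of the target automorphism\<close>

text \<open>
  On the line \<open>\<complex> v\<close> the involution has its pole at \<open>v / \<langle>v, b\<rangle>\<close>, where its numerator takes the value
  \<open>polar_part b v / \<langle>v, b\<rangle>\<close>. In projective terms, \<open>polar_part b\<close> is the map that the involution induces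
  from the polar hyperplane to the hyperplane at infinity, extended linearly to all \<open>v\<close>.
\<close>

definition polar_part :: "complex ^ 'n::finite \<Rightarrow> complex ^ 'n \<Rightarrow> complex ^ 'n" where
  "polar_part b v = contraction b *s ((cdot v b / (1 + contraction b)) *s b - v)"

lemma polar_part_add: "polar_part b (x + y) = polar_part b x + polar_part b y"
  by (simp add: polar_part_def vec_eq_iff cdot_simps algebra_simps add_divide_distrib)

lemma polar_part_scale: "polar_part b (c *s x) = c *s polar_part b x"
  by (simp add: polar_part_def vec_eq_iff cdot_simps algebra_simps)

lemma surj_polar_part:
  assumes "norm b < 1"
  shows "surj (polar_part b)"
proof -
  define s where "s = contraction b"
  have s: "s * s = 1 - cdot b b" "s \<noteq> 0" "1 + s \<noteq> 0"
    using contraction_props[OF assms] by (auto simp: s_def)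
  have lin: "linear (polar_part b)"
  proof (rule linearI)
    show "polar_part b (r *\<^sub>R x) = r *\<^sub>R polar_part b x" for r x
      by (simp only: scaleR_eq_scale_vec polar_part_scale)
  qed (rule polar_part_add)
  \<comment> \<open>\<open>polar_part b\<close> is injective: pairing a kernel element with \<open>b\<close> gives \<open>s \<langle>v, b\<rangle> = 0\<close>\<close>
  have "v = 0" if "polar_part b v = 0" for v
  proof -
    have v: "v = (cdot v b / (1 + s)) *s b"
      using that s(2) unfolding polar_part_def s_def[symmetric] vector_mul_eq_0 by simp
    have "cdot v b = cdot v b / (1 + s) * cdot b b"
      by (subst (1) v) (simp add: cdot_scale_left)
    also have "cdot b b = (1 + s) * (1 - s)" using s(1) by (simp add: algebra_simps)
    finally have "cdot v b = cdot v b * (1 - s)" using s(3) by simp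
    then have "cdot v b = 0" using s(2) by (simp add: algebra_simps)
    then show "v = 0" using v by simp
  qed
  then have "inj (polar_part b)"
    using linear_injective_0[OF lin] by blast
  then show ?thesis by (rule linear_inj_imp_surj[OF lin])
qed

text \<open>
  The polynomial \<open>h\<close> is the denominator that the target automorphism produces, and \<open>p\<close> is one component
  of the map. Write \<open>q = 1 - \<langle>z, b\<rangle>\<close>. On the line \<open>\<complex> v\<close>, clearing denominators gives polynomials in one
  variable with \<open>P H = q\<^sup>d R\<close>, where \<open>P = q\<^sup>d (p \<circ> \<gamma>)\<close> with \<open>\<gamma> = U \<circ> ball_involution b\<close>. At the zero of \<open>q\<close> only the part of \<open>p\<close> of top
  degree \<open>d\<close> contributes to \<open>P\<close>, and it is evaluated at a multiple of \<open>U (polar_part b v)\<close>. If that value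
  is nonzero, then \<open>p \<circ> \<gamma>\<close> has a pole of order exactly \<open>d\<close>, so \<open>H\<close> takes up the whole factor \<open>q\<^sup>d\<close>.
\<close>

lemma denominator_on_generic_line:
  fixes b v :: "complex ^ 'n::finite" and p h r :: "nat ^ 'n \<Rightarrow> complex"
  assumes S: "finite S" "\<And>\<alpha>. \<alpha> \<in> S \<Longrightarrow> total_degree \<alpha> \<le> d" and b: "norm b < 1"
    and eq: "\<And>z. norm z < 1 \<Longrightarrow>
      poly_val S p (U *v ball_involution b z) * poly_val S h z = poly_val S r z"
    and v: "cdot v b \<noteq> 0"
    and top: "poly_val {\<alpha> \<in> S. total_degree \<alpha> = d} p (U *v polar_part b v) \<noteq> 0"
  shows "poly_val S h (\<zeta> *s v) = poly_val S h 0 * (1 - \<zeta> * cdot v b) ^ d"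
proof -
  define s where "s = contraction b"
  define m where "m = cdot v b"
  define w where "w = - ((m / (1 + s)) *s b) - s *s v"
  define Q where "Q = [:1, - m:]"
  define P where "P = (\<Sum>\<alpha>\<in>S. smult (p \<alpha>) (Q ^ (d - total_degree \<alpha>) * affine_monom \<alpha> (U *v b) (U *v w)))"
  define H where "H = affine_restriction S h 0 v"
  define R where "R = affine_restriction S r 0 v"
  have H: "poly H t = poly_val S h (t *s v)" for t by (simp add: H_def poly_affine_restriction)
  have R: "poly R t = poly_val S r (t *s v)" for t by (simp add: R_def poly_affine_restriction)
  have Q: "poly Q t = 1 - t * m" for t by (simp add: Q_def)
  have P: "poly P t = (\<Sum>\<alpha>\<in>S. p \<alpha> * ((1 - t * m) ^ (d - total_degree \<alpha>) * monomial_val \<alpha> (U *v (b + t *s w))))" for t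
    by (simp add: P_def poly_sum poly_affine_monom Q matrix_vector_right_distrib vector_scalar_commute)
  have num: "ball_involution b (t *s v) = (1 / (1 - t * m)) *s (b + t *s w)" for t
    unfolding ball_involution_def cdot_scale_left m_def[symmetric] s_def[symmetric] w_def
    by (simp add: vec_eq_iff algebra_simps)
  have "P * H = Q ^ d * R"
  proof (rule poly_eq_near_0)
    show "1 / (1 + norm v) > 0" by (simp add: add_pos_nonneg)
    fix t assume "cmod t < 1 / (1 + norm v)"
    then have "cmod t * (1 + norm v) < 1"
      by (simp add: pos_less_divide_eq add_pos_nonneg)
    moreover have "cmod t * norm v \<le> cmod t * (1 + norm v)"
      by (intro mult_left_mono) auto
    ultimately have t: "norm (t *s v) < 1"
      unfolding norm_scale_vec by linarith
    have ne: "1 - t * m \<noteq> 0"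
      using cdot_ball_ne_1[OF t b] by (auto simp: cdot_scale_left m_def)
    have "poly P t = (1 - t * m) ^ d * poly_val S p (U *v ball_involution b (t *s v))"
      unfolding P poly_val_def sum_distrib_left
    proof (rule sum.cong[OF refl])
      fix \<alpha> assume "\<alpha> \<in> S"
      from S(2)[OF this] have "(1 - t * m) ^ (d - total_degree \<alpha>)
          = (1 - t * m) ^ d * (1 / (1 - t * m)) ^ total_degree \<alpha>"
        using ne by (simp add: power_diff power_divide)
      then show "p \<alpha> * ((1 - t * m) ^ (d - total_degree \<alpha>) * monomial_val \<alpha> (U *v (b + t *s w))) =
        (1 - t * m) ^ d * (p \<alpha> * monomial_val \<alpha> (U *v ball_involution b (t *s v)))"
        unfolding num vector_scalar_commute monomial_val_scale by (simp only: mult_ac)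
    qed
    then have "poly P t * poly H t = (1 - t * m) ^ d * poly_val S r (t *s v)"
      using eq[OF t] unfolding H by (simp add: mult.assoc)
    then show "poly (P * H) t = poly (Q ^ d * R) t" by (simp add: Q R)
  qed
  moreover have "poly P (1 / m) \<noteq> 0"
  proof -
    have m: "m \<noteq> 0" using v by (simp add: m_def)
    have "1 + s \<noteq> 0" using contraction_props[OF b] by (simp add: s_def)
    then have "m *s (b + (1 / m) *s w) = polar_part b v"
      using m by (simp add: polar_part_def w_def vec_eq_iff s_def[symmetric] m_def[symmetric]
          field_simps)
    then have "b + (1 / m) *s w = (1 / m) *s polar_part b v"
      using m by (metis divide_self_if mult_1 times_divide_eq_left vector_smult_assoc vector_smult_lid)
    then have "U *v (b + (1 / m) *s w) = (1 / m) *s (U *v polar_part b v)"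
      by (simp only: vector_scalar_commute)
    then have val: "monomial_val \<alpha> (U *v (b + (1 / m) *s w))
        = (1 / m) ^ total_degree \<alpha> * monomial_val \<alpha> (U *v polar_part b v)" for \<alpha>
      by (simp only: monomial_val_scale)
    have "poly P (1 / m) = (\<Sum>\<alpha>\<in>S. if total_degree \<alpha> = d
        then (1 / m) ^ d * (p \<alpha> * monomial_val \<alpha> (U *v polar_part b v)) else 0)"
      unfolding P val using m S(2) by (intro sum.cong) (auto simp: le_less)
    also have "\<dots> = (1 / m) ^ d * poly_val {\<alpha> \<in> S. total_degree \<alpha> = d} p (U *v polar_part b v)"
      using S(1) by (simp add: poly_val_def sum_distrib_left flip: sum.inter_filter)
    finally show ?thesis using top m by simp
  qed
  ultimately have "poly H \<zeta> = poly H 0 * (1 - \<zeta> * m) ^ d"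
    using v unfolding Q_def
    by (intro linear_power_cofactor[of P H m d R])
      (auto simp: m_def H_def intro: degree_affine_restriction S)
  then show ?thesis by (simp add: H m_def)
qed

lemma continuous_poly_val:
  assumes "\<And>j. continuous_on T (\<lambda>t. x t $ j)"
  shows "continuous_on T (\<lambda>t. poly_val S c (x t))"
  unfolding poly_val_def monomial_val_def by (intro continuous_intros assms)

text \<open>
  The part of \<open>p\<close> of degree \<open>d\<close> does not vanish identically and \<open>U \<circ> polar_part b\<close> is onto, so some
  direction \<open>x\<close> makes it nonzero. Along the path from \<open>v\<close> to \<open>x\<close> it is a nonzero polynomial in the
  parameter, so directions arbitrarily close to \<open>v\<close> are generic; the identity passes to the limit.
\<close>

lemma denominator_on_line:
  fixes b v :: "complex ^ 'n::finite" and p h r :: "nat ^ 'n \<Rightarrow> complex"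
  assumes S: "finite S" "\<And>\<alpha>. \<alpha> \<in> S \<Longrightarrow> total_degree \<alpha> \<le> d" and b: "norm b < 1"
    and eq: "\<And>z. norm z < 1 \<Longrightarrow>
      poly_val S p (U *v ball_involution b z) * poly_val S h z = poly_val S r z"
    and U: "surj ((*v) U)"
    and top: "\<alpha>\<^sub>0 \<in> S" "total_degree \<alpha>\<^sub>0 = d" "p \<alpha>\<^sub>0 \<noteq> 0"
    and v: "cdot v b \<noteq> 0"
  shows "poly_val S h (\<zeta> *s v) = poly_val S h 0 * (1 - \<zeta> * cdot v b) ^ d"
proof -
  define S' where "S' = {\<alpha> \<in> S. total_degree \<alpha> = d}"
  obtain y where y: "poly_val S' p y \<noteq> 0"
    using poly_val_nonzero[of S' \<alpha>\<^sub>0 p] S(1) top by (auto simp: S'_def)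
  obtain u where "y = U *v u" using U by (auto simp: surj_def)
  moreover obtain x where "u = polar_part b x"
    using surj_polar_part[OF b] by (auto simp: surj_def)
  ultimately have x: "poly_val S' p (U *v polar_part b x) \<noteq> 0" using y by simp
  define g where "g t = v + t *s (x - v)" for t :: complex
  define q where "q = affine_restriction S' p (U *v polar_part b v) (U *v polar_part b (x - v))"
  have q: "poly q t = poly_val S' p (U *v polar_part b (g t))" for t
    unfolding q_def poly_affine_restriction g_def polar_part_add polar_part_scale
      matrix_vector_right_distrib vector_scalar_commute ..
  have "poly q 1 \<noteq> 0" unfolding q using x by (simp add: g_def)
  then have "finite {t. poly q t = 0}" by (intro poly_roots_finite) auto
  then have q_ne: "\<forall>\<^sub>F t in at 0. t \<notin> {t. poly q t = 0}"
    using islimpt_finite islimpt_iff_eventually by blast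
  define k where "k t = cdot (g t) b" for t
  have k: "continuous_on UNIV k"
    unfolding k_def g_def cdot_simps by (intro continuous_intros)
  then have "(k \<longlongrightarrow> k 0) (at 0)" by (simp add: continuous_on_eq_continuous_at isCont_def)
  moreover have "k 0 \<noteq> 0" using v by (simp add: k_def g_def)
  ultimately have k_ne: "\<forall>\<^sub>F t in at 0. k t \<noteq> 0" by (rule tendsto_imp_eventually_ne)
  have ev: "\<forall>\<^sub>F t in at 0. poly_val S h (\<zeta> *s g t) = poly_val S h 0 * (1 - \<zeta> * k t) ^ d"
    using q_ne k_ne
  proof eventually_elim
    case (elim t)
    then show ?case
      using denominator_on_generic_line[OF S b eq, of "g t" \<zeta>] by (simp add: q S'_def k_def)
  qed
  have "continuous_on UNIV (\<lambda>t. poly_val S h (\<zeta> *s g t))"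
    by (rule continuous_poly_val) (simp add: g_def, intro continuous_intros)
  then have "((\<lambda>t. poly_val S h (\<zeta> *s g t)) \<longlongrightarrow> poly_val S h (\<zeta> *s g 0)) (at 0)"
    by (auto simp: continuous_on_eq_continuous_at isCont_def)
  moreover have "continuous_on UNIV (\<lambda>t. poly_val S h 0 * (1 - \<zeta> * k t) ^ d)"
    by (intro continuous_intros k)
  then have "((\<lambda>t. poly_val S h 0 * (1 - \<zeta> * k t) ^ d) \<longlongrightarrow> poly_val S h 0 * (1 - \<zeta> * k 0) ^ d) (at 0)"
    by (auto simp: continuous_on_eq_continuous_at isCont_def)
  then have "((\<lambda>t. poly_val S h (\<zeta> *s g t)) \<longlongrightarrow> poly_val S h 0 * (1 - \<zeta> * k 0) ^ d) (at 0)"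
    using ev by (simp add: tendsto_cong)
  ultimately have "poly_val S h (\<zeta> *s g 0) = poly_val S h 0 * (1 - \<zeta> * k 0) ^ d"
    using tendsto_unique[OF trivial_limit_at] by blast
  then show ?thesis by (simp add: g_def k_def)
qed

text \<open>
  On the \<open>j\<close>-th axis only pure powers of \<open>z\<^sub>j\<close> survive, while every binomial coefficient in
  \<open>(1 - m \<zeta>)\<^sup>d\<close> is nonzero.
\<close>

lemma pure_powers_of_linear_power:
  fixes h :: "nat ^ 'n::finite \<Rightarrow> complex"
  assumes "finite S" and eq: "\<And>\<zeta>. poly_val S h (\<zeta> *s axis j 1) = e * (1 - \<zeta> * m) ^ d"
    and "e \<noteq> 0" "m \<noteq> 0" "k \<le> d"
  shows "axis j k \<in> S \<and> h (axis j k) \<noteq> 0"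
proof (rule ccontr)
  assume neg: "\<not> (axis j k \<in> S \<and> h (axis j k) \<noteq> 0)"
  define p where "p = (\<Sum>\<alpha>\<in>S. if \<alpha> = axis j (\<alpha> $ j) then monom (h \<alpha>) (\<alpha> $ j) else 0)"
  have "poly p \<zeta> = poly_val S h (\<zeta> *s axis j 1)" for \<zeta>
    unfolding p_def poly_val_def poly_sum monomial_val_axis by (rule sum.cong) (auto simp: poly_monom)
  then have "poly p = poly (smult e ([:1, - m:] ^ d))"
    by (simp add: fun_eq_iff eq)
  then have "p = smult e ([:1, - m:] ^ d)" by (simp add: poly_eq_poly_eq_iff)
  then have "coeff p k \<noteq> 0"
    using assms by (simp add: coeff_linear_poly_power)
  moreover have "coeff p k = 0"
    unfolding p_def coeff_sum
  proof (rule sum.neutral, rule ballI)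
    fix \<alpha> assume "\<alpha> \<in> S"
    then show "coeff (if \<alpha> = axis j (\<alpha> $ j) then monom (h \<alpha>) (\<alpha> $ j) else 0) k = 0"
      using neg by (cases "\<alpha> $ j = k") auto
  qed
  ultimately show False by contradiction
qed

section \<open>Pure powers in a polynomial map with a symmetry moving the origin\<close>

lemma homog_nth [simp]: "homog w \<zeta> $ None = \<zeta>" "homog w \<zeta> $ Some j = w $ j"
  by (simp_all add: homog_def)

lemma eval_polymap_nth:
  "eval_polymap f z $ i = poly_val (insert 0 (Poly_Mapping.keys f)) (\<lambda>\<alpha>. Poly_Mapping.lookup f \<alpha> $ i) z"
proof -
  have "eval_polymap f z $ i = (\<Sum>\<alpha>\<in>Poly_Mapping.keys f. Poly_Mapping.lookup f \<alpha> $ i * monomial_val \<alpha> z)"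
    by (simp add: eval_polymap_def mult.commute)
  also have "\<dots> = poly_val (insert 0 (Poly_Mapping.keys f)) (\<lambda>\<alpha>. Poly_Mapping.lookup f \<alpha> $ i) z"
    unfolding poly_val_def by (rule sum.mono_neutral_left) (auto simp: in_keys_iff)
  finally show ?thesis .
qed

text \<open>
  The coefficients of the \<open>i\<close>-th entry of \<open>A (f, 1)\<close>, a polynomial in \<open>z\<close>. The entry \<open>1\<close> contributes only
  to the constant term, so the coefficient at \<open>\<alpha> \<noteq> 0\<close> depends linearly on the coefficient of \<open>f\<close> at \<open>\<alpha>\<close>.
\<close>

definition row_coeff :: "complex ^ 'N::finite option ^ 'N option \<Rightarrow> ('n::finite, 'N) polymap \<Rightarrow>
    'N option \<Rightarrow> nat ^ 'n \<Rightarrow> complex" where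
  "row_coeff A f i \<alpha> = (\<Sum>j\<in>UNIV. A $ i $ Some j * Poly_Mapping.lookup f \<alpha> $ j)
      + (if \<alpha> = 0 then A $ i $ None else 0)"

lemma poly_val_row_coeff:
  "poly_val (insert 0 (Poly_Mapping.keys f)) (row_coeff A f i) z = (A *v homog (eval_polymap f z) 1) $ i"
proof -
  let ?S = "insert 0 (Poly_Mapping.keys f)"
  have m0: "monomial_val 0 z = 1" by (simp add: monomial_val_def)
  have ev: "eval_polymap f z $ j = (\<Sum>\<alpha>\<in>?S. Poly_Mapping.lookup f \<alpha> $ j * monomial_val \<alpha> z)" for j
    by (simp only: eval_polymap_nth poly_val_def)
  have "(A *v homog (eval_polymap f z) 1) $ i
      = A $ i $ None + (\<Sum>j\<in>UNIV. A $ i $ Some j * eval_polymap f z $ j)"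
    by (simp add: matrix_vector_mult_def UNIV_option_conv sum.reindex)
  also have "(\<Sum>j\<in>UNIV. A $ i $ Some j * eval_polymap f z $ j)
      = (\<Sum>\<alpha>\<in>?S. (\<Sum>j\<in>UNIV. A $ i $ Some j * Poly_Mapping.lookup f \<alpha> $ j) * monomial_val \<alpha> z)"
    unfolding ev sum_distrib_left sum_distrib_right by (subst sum.swap) (simp only: mult.assoc)
  also have "A $ i $ None = (\<Sum>\<alpha>\<in>?S. (if \<alpha> = 0 then A $ i $ None else 0) * monomial_val \<alpha> z)"
  proof -
    have "(\<Sum>\<alpha>\<in>?S. (if \<alpha> = 0 then A $ i $ None else 0) * monomial_val \<alpha> z)
        = (\<Sum>\<alpha>\<in>?S. if \<alpha> = 0 then A $ i $ None else 0)"
      by (rule sum.cong) (auto simp: m0)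
    then show ?thesis by simp
  qed
  finally show ?thesis
    by (simp only: poly_val_def row_coeff_def distrib_right sum.distrib add.commute)
qed

theorem theorem6p1:
  fixes f :: "('n::finite, 'N::finite) polymap"
    and L :: "'N set"
    and d :: nat
  assumes "proper_ball_map L (proj_polymap f)"
    and "polymap_degree f = d"
    and "\<exists>\<gamma>\<in>invariant_group L (proj_polymap f). \<gamma> 0 \<noteq> 0"
  shows "\<exists>j :: 'n. \<forall>k. 1 \<le> k \<and> k \<le> d \<longrightarrow> appears_in (axis j k) f"
proof (cases "d = 0")
  case False
  define S where "S = insert 0 (Poly_Mapping.keys f)"
  obtain \<gamma> \<psi> where \<gamma>: "\<gamma> \<in> ball_aut" "\<gamma> 0 \<noteq> 0" and "\<psi> \<in> gen_ball_aut L"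
    and \<psi>: "\<And>z. z \<in> unit_ball \<Longrightarrow> proj_polymap f (\<gamma> z) = \<psi> (proj_polymap f z)"
    using assms(3) unfolding invariant_group_def by blast
  then obtain A where A: "\<psi> = restrict ((`) ((*v) A)) (gen_ball L)"
    by (auto simp: gen_ball_aut_def)
  obtain b U where b: "norm b < 1" "\<gamma> b = 0" and U: "surj ((*v) U)"
    and \<gamma>U: "\<And>z. norm z < 1 \<Longrightarrow> \<gamma> z = U *v ball_involution b z"
    using ball_aut_factorization[OF \<gamma>(1)] by metis
  define R where "R i z = poly_val S (row_coeff A f i) z" for i z
  \<comment> \<open>the entry \<open>None\<close> of \<open>A (f, 1)\<close> is the denominator of \<open>\<psi> \<circ> f\<close>; it cannot vanish because \<open>f \<circ> \<gamma>\<close> is finite\<close>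
  have lift: "R None z \<noteq> 0 \<and> eval_polymap f (\<gamma> z) $ i * R None z = R (Some i) z"
    if z: "norm z < 1" for z i
  proof -
    have "proj_polymap f z \<in> gen_ball L"
      using assms(1) z by (auto simp: proper_ball_map_def)
    then have "proj_polymap f (\<gamma> z) = (*v) A ` proj_polymap f z"
      using \<psi>[of z] z by (simp add: A)
    moreover have "homog (eval_polymap f (\<gamma> z)) 1 \<in> proj_polymap f (\<gamma> z)"
      unfolding proj_polymap_def line_def by (rule image_eqI[of _ _ 1]) auto
    ultimately obtain c where "homog (eval_polymap f (\<gamma> z)) 1 = A *v (c *s homog (eval_polymap f z) 1)"
      unfolding proj_polymap_def line_def by auto
    then have "homog (eval_polymap f (\<gamma> z)) 1 $ k = c * R k z" for k
      by (simp add: R_def S_def poly_val_row_coeff vector_scalar_commute)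
    from this[of None] this[of "Some i"] show ?thesis by auto
  qed
  have deg: "d = Max (insert 0 (total_degree ` Poly_Mapping.keys f))"
    using assms(2) unfolding polymap_degree_def total_degree_def by simp
  have S: "finite S" by (simp add: S_def)
  have total: "total_degree \<alpha> \<le> d" if "\<alpha> \<in> S" for \<alpha>
    using that unfolding deg S_def by (auto simp: total_degree_def)
  have "d \<in> insert 0 (total_degree ` Poly_Mapping.keys f)"
    unfolding deg by (rule Max_in) auto
  then obtain \<alpha>\<^sub>0 where \<alpha>\<^sub>0: "\<alpha>\<^sub>0 \<in> Poly_Mapping.keys f" "total_degree \<alpha>\<^sub>0 = d"
    using False by auto
  then obtain i where i: "Poly_Mapping.lookup f \<alpha>\<^sub>0 $ i \<noteq> 0"
    by (auto simp: in_keys_iff vec_eq_iff)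
  have eq: "poly_val S (\<lambda>\<alpha>. Poly_Mapping.lookup f \<alpha> $ i) (U *v ball_involution b z)
      * poly_val S (row_coeff A f None) z = poly_val S (row_coeff A f (Some i)) z" if "norm z < 1" for z
    using lift[OF that, of i] by (simp add: R_def eval_polymap_nth S_def flip: \<gamma>U[OF that])
  \<comment> \<open>this is where it matters that \<open>\<gamma>\<close> moves the origin\<close>
  have "b \<noteq> 0" using \<gamma>(2) b(2) by auto
  then obtain j where j: "b $ j \<noteq> 0" by (auto simp: vec_eq_iff)
  have line: "poly_val S (row_coeff A f None) (\<zeta> *s axis j 1)
      = R None 0 * (1 - \<zeta> * cnj (b $ j)) ^ d" for \<zeta>
    using denominator_on_line[OF S total b(1) eq U,
        where \<alpha>\<^sub>0 = \<alpha>\<^sub>0 and v = "axis j 1" and \<zeta> = \<zeta>] \<alpha>\<^sub>0 i j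
    by (simp add: R_def S_def cdot_axis_left)
  show ?thesis
  proof (intro exI[of _ j] allI impI)
    fix k assume k: "1 \<le> k \<and> k \<le> d"
    have "row_coeff A f None (axis j k) \<noteq> 0"
      using pure_powers_of_linear_power[OF S line, of k] lift[of 0] j k by simp
    moreover have "axis j k \<noteq> (0 :: nat ^ 'n)"
      using k by (metis axis_eq_0_iff not_one_le_zero)
    ultimately have "Poly_Mapping.lookup f (axis j k) \<noteq> 0"
      by (auto simp: row_coeff_def)
    then show "appears_in (axis j k) f" by (simp add: appears_in_def)
  qed
qed simp

end
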